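(* Let $G$ be a finite group and $H$ a non-trivial proper normal subgroup of $G$. Then for any odd integers $k,l$ between $1$ and $|H|$ (inclusive), $H$ is a $(0,k)$-regular set of $G$ if and only if it is a $(0,l)$-regular set of $G$. In particular, for any odd integer $k$ between $1$ and $|H|$, $H$ is a $(0,1)$-regular set of $G$ if and only if it is a $(0,k)$-regular set of $G$.
   Context: All groups are finite. $e$ is the identity of $G$. For an inverse-closed subset $S$ of $G\setminus\{e\}$ (i.e. $S^{-1}=S$), $\mathrm{Cay}(G,S)$ is the graph with vertex set $G$ and edge set $\{\{x,y\}: x,y\in G,\ yx^{-1}\in S\}$. A $(0,k)$-regular set in a graph $\Gamma$ is a nonempty proper subset $D$ of $V(\Gamma)$ such that every vertex in $D$ has no neighbour in $D$ and every vertex in $V(\Gamma)\setminus D$ has exactly $k$ neighbours in $D$. A subset $D$ of a group $G$ is a $(0,k)$-regular set of $G$ if it is a $(0,k)$-regular set in $\mathrm{Cay}(G,S)$ for some inverse-closed $S\subseteq G\setminus\{e\}$. *)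

theory Defs
  imports "HOL-Algebra.Coset" "Graph_Theory.Pair_Digraph"
begin

text \<open>
  An undirected simple graph is a \<open>pair_graph\<close> in the sense of Graph Theory: the edge
  \<open>{x, y}\<close> is represented by the two arcs \<open>(x, y)\<close> and \<open>(y, x)\<close>.
\<close>

definition neighbours :: "'a pair_pre_digraph \<Rightarrow> 'a \<Rightarrow> 'a set" where
  "neighbours \<Gamma> v = {w. (v, w) \<in> parcs \<Gamma>}"

definition zero_regular_set_in :: "nat \<Rightarrow> 'a pair_pre_digraph \<Rightarrow> 'a set \<Rightarrow> bool" where
  "zero_regular_set_in k \<Gamma> D \<longleftrightarrow>
     D \<noteq> {} \<and> D \<subset> pverts \<Gamma> \<and>
     (\<forall>v\<in>D. neighbours \<Gamma> v \<inter> D = {}) \<and>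
     (\<forall>v\<in>pverts \<Gamma> - D. card (neighbours \<Gamma> v \<inter> D) = k)"

definition connection_set :: "('a, 'b) monoid_scheme \<Rightarrow> 'a set \<Rightarrow> bool" where
  "connection_set G S \<longleftrightarrow> S \<subseteq> carrier G - {\<one>\<^bsub>G\<^esub>} \<and> set_inv\<^bsub>G\<^esub> S = S"

definition Cay :: "('a, 'b) monoid_scheme \<Rightarrow> 'a set \<Rightarrow> 'a pair_pre_digraph" where
  "Cay G S =
     \<lparr>pverts = carrier G,
      parcs = {(x, y). x \<in> carrier G \<and> y \<in> carrier G \<and> y \<otimes>\<^bsub>G\<^esub> inv\<^bsub>G\<^esub> x \<in> S}\<rparr>"

lemma pair_graph_Cay:
  assumes "group G" and fin: "finite (carrier G)" and S: "connection_set G S"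
  shows "pair_graph (Cay G S)"
proof -
  interpret group G by fact
  have inv_S: "inv\<^bsub>G\<^esub> s \<in> S" if "s \<in> S" for s
    using S that by (auto simp: connection_set_def SET_INV_def)
  have "finite (parcs (Cay G S))"
    by (rule finite_subset[of _ "carrier G \<times> carrier G"]) (auto simp: Cay_def fin)
  moreover have "sym (parcs (Cay G S))"
  proof (rule symI)
    fix x y assume xy: "(x, y) \<in> parcs (Cay G S)"
    then have "inv\<^bsub>G\<^esub> (y \<otimes>\<^bsub>G\<^esub> inv\<^bsub>G\<^esub> x) = x \<otimes>\<^bsub>G\<^esub> inv\<^bsub>G\<^esub> y"
      by (auto simp: Cay_def inv_mult_group)
    with xy inv_S[of "y \<otimes>\<^bsub>G\<^esub> inv\<^bsub>G\<^esub> x"] show "(y, x) \<in> parcs (Cay G S)"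
      by (auto simp: Cay_def)
  qed
  ultimately show ?thesis
    using S fin
    by unfold_locales
      (auto simp: Cay_def connection_set_def symmetric_def with_proj_def arcs_ends_def arc_to_ends_def)
qed

definition zero_regular_set_of :: "nat \<Rightarrow> ('a, 'b) monoid_scheme \<Rightarrow> 'a set \<Rightarrow> bool" where
  "zero_regular_set_of k G D \<longleftrightarrow>
     (\<exists>S. connection_set G S \<and> zero_regular_set_in k (Cay G S) D)"

end

theory Submission
  imports Defs
begin

text \<open>
  The subgroup \<open>H\<close> is a \<open>(0,k)\<close>-regular set of \<open>Cay(G, S)\<close> exactly when \<open>S\<close> misses \<open>H\<close> and meets
  every other coset of \<open>H\<close> in \<open>k\<close> elements. As \<open>H\<close> is normal, inversion permutes the cosets. On a
  pair of distinct mutually inverse cosets, \<open>S\<close> can be any \<open>k\<close> elements of one of them together with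
  their inverses. On a coset \<open>C = C\<inverse>\<close>, an inverse-closed subset of odd size contains an element with
  \<open>x = x\<inverse>\<close>; conversely, starting from such an element and adding two elements at a time (a pair
  \<open>{y, y\<inverse>}\<close> or two self-inverse elements) one reaches every odd size up to \<open>|C|\<close>. So for odd \<open>k\<close>
  the condition on \<open>G\<close> and \<open>H\<close> does not depend on \<open>k\<close>.
\<close>

text \<open>Points moved by \<open>f\<close> come in pairs {x, f x}. Deleting one such pair keeps
  the set closed under \<open>f\<close> and its size odd, so strong induction on the size
  applies.\<close>

lemma involution_fixed_point:
  assumes "finite A" and "odd (card A)"
    and "\<And>x. x \<in> A \<Longrightarrow> f x \<in> A" and "\<And>x. x \<in> A \<Longrightarrow> f (f x) = x"
  shows "\<exists>x\<in>A. f x = x"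
  using assms
proof (induction "card A" arbitrary: A rule: less_induct)
  case less
  then have "A \<noteq> {}" by auto
  then obtain x where x: "x \<in> A" by blast
  show ?case
  proof (cases "f x = x")
    case False
    let ?B = "A - {x, f x}"
    have "{x, f x} \<subseteq> A" using x less.prems by auto
    then have card: "card ?B = card A - 2" "2 \<le> card A"
      using False less.prems(1) card_mono[of A "{x, f x}"] by (auto simp: card_Diff_subset)
    have "f y \<in> ?B" if "y \<in> ?B" for y
    proof -
      \<comment> \<open>Applying \<open>f\<close> to either equation would give y = f x or y =
        x.\<close>
      have "f y \<noteq> x" "f y \<noteq> f x" using that x less.prems(4) by (metis Diff_iff insertCI)+
      then show ?thesis using that less.prems(3) by auto
    qed
    then have "\<exists>y\<in>?B. f y = y"
      using less.hyps[of ?B] less.prems card by auto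
    then show ?thesis by blast
  qed (use x in auto)
qed

lemma involution_closed_subset_odd_card:
  assumes fin: "finite C"
    and f: "\<And>x. x \<in> C \<Longrightarrow> f x \<in> C" "\<And>x. x \<in> C \<Longrightarrow> f (f x) = x"
    and x: "x \<in> C" "f x = x"
    and n: "2 * n + 1 \<le> card C"
  shows "\<exists>A\<subseteq>C. card A = 2 * n + 1 \<and> (\<forall>y\<in>A. f y \<in> A)"
  using n
proof (induction n)
  case 0
  show ?case using x by (intro exI[of _ "{x}"]) auto
next
  case (Suc n)
  then obtain A where A: "A \<subseteq> C" "card A = 2 * n + 1" "\<forall>y\<in>A. f y \<in> A" by auto
  have finA: "finite A" using A(1) fin finite_subset by blast
  have "2 \<le> card (C - A)" using A(1,2) finA Suc.prems by (simp add: card_Diff_subset)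
  then obtain B where B: "B \<subseteq> C - A" "card B = 2"
    by (meson obtain_subset_with_card_n)
  \<comment> \<open>At least two points remain outside \<open>A\<close>. If \<open>f\<close> fixes
    all of them, any two will do, hence \<open>B\<close>. Otherwise a moved \<open>y\<close> brings
    \<open>f y\<close> along, which is outside \<open>A\<close> too because \<open>A\<close> is
    closed under \<open>f\<close> and f (f y) = y.\<close>
  have "\<exists>D\<subseteq>C - A. card D = 2 \<and> (\<forall>y\<in>D. f y \<in> D)"
  proof (cases "\<forall>y\<in>C - A. f y = y")
    case True
    then show ?thesis using B by (intro exI[of _ B]) auto
  next
    case False
    then obtain y where y: "y \<in> C - A" "f y \<noteq> y" by blast
    then have "f y \<in> C - A" using A(3) f by (metis Diff_iff)
    then show ?thesis using y f by (intro exI[of _ "{y, f y}"]) auto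
  qed
  then obtain D where D: "D \<subseteq> C - A" "card D = 2" "\<forall>y\<in>D. f y \<in> D" by blast
  have "card (A \<union> D) = card A + card D"
    using D finA fin by (intro card_Un_disjoint) (auto intro: finite_subset)
  then show ?case using A D by (intro exI[of _ "A \<union> D"]) auto
qed

lemma (in group) in_set_inv_iff:
  assumes "A \<subseteq> carrier G" and "x \<in> carrier G"
  shows "x \<in> set_inv A \<longleftrightarrow> inv x \<in> A"
  using assms by (force simp: SET_INV_def)

lemma (in group) set_inv_set_inv:
  assumes "A \<subseteq> carrier G"
  shows "set_inv (set_inv A) = A"
proof -
  have "set_inv (set_inv A) = (\<lambda>x. inv (inv x)) ` A" by (auto simp: SET_INV_def)
  also have "\<dots> = (\<lambda>x. x) ` A" using assms by (intro image_cong) auto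
  finally show ?thesis by simp
qed

lemma (in group) card_set_inv:
  assumes "A \<subseteq> carrier G"
  shows "card (set_inv A) = card A"
proof -
  have "set_inv A = (\<lambda>x. inv x) ` A" by (auto simp: SET_INV_def)
  then show ?thesis using assms by (simp add: card_image inj_on_subset[OF inv_inj])
qed

lemma (in normal) set_inv_rcosets:
  assumes "C \<in> rcosets H"
  shows "set_inv C \<in> rcosets H"
  using assms rcos_inv by (auto simp: RCOSETS_def)

text \<open>Right multiplication by \<open>inv v\<close> carries the neighbours \<open>w\<close> of
  \<open>v\<close> to the elements w v^(-1) of \<open>S\<close>, and \<open>H\<close> to the coset
  of \<open>inv v\<close>.\<close>

lemma (in normal) card_neighbours_Cay:
  assumes v: "v \<in> carrier G" and S: "S \<subseteq> carrier G"
  shows "card (neighbours (Cay G S) v \<inter> H) = card (S \<inter> (H #> inv v))"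
proof (rule bij_betw_same_card)
  show "bij_betw (\<lambda>w. w \<otimes> inv v) (neighbours (Cay G S) v \<inter> H) (S \<inter> (H #> inv v))"
    using v by (auto simp: bij_betw_def inj_on_def neighbours_def Cay_def r_coset_def)
qed

lemma (in normal) zero_regular_set_of_iff:
  assumes fin: "finite (carrier G)" and proper: "H \<noteq> carrier G"
  shows "zero_regular_set_of k G H \<longleftrightarrow>
    (\<exists>S. connection_set G S \<and> S \<inter> H = {} \<and> (\<forall>C\<in>rcosets H - {H}. card (S \<inter> C) = k))"
proof -
  have "zero_regular_set_in k (Cay G S) H \<longleftrightarrow>
      S \<inter> H = {} \<and> (\<forall>C\<in>rcosets H - {H}. card (S \<inter> C) = k)" if "connection_set G S" for S
  proof -
    have S: "S \<subseteq> carrier G" using that by (auto simp: connection_set_def)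
    then have finS: "finite S" using fin finite_subset by blast
    \<comment> \<open>For \<open>v\<close> in \<open>H\<close> the coset of \<open>inv v\<close> is
      \<open>H\<close> itself. Emptiness is read off from cardinality 0, so finiteness matters
      here.\<close>
    have empty_iff: "neighbours (Cay G S) v \<inter> H = {} \<longleftrightarrow> S \<inter> H = {}" if "v \<in> H" for v
    proof -
      have "neighbours (Cay G S) v \<inter> H = {} \<longleftrightarrow> card (neighbours (Cay G S) v \<inter> H) = 0"
        by (simp add: finite_subset[OF _ fin] subset)
      also have "\<dots> \<longleftrightarrow> card (S \<inter> H) = 0"
        using that card_neighbours_Cay[OF _ S, of v] coset_join2[OF _ is_subgroup, of "inv v"] by auto
      finally show ?thesis using finS by simp
    qed
    have rcosets_eq: "rcosets H - {H} = (\<lambda>v. H #> inv v) ` (carrier G - H)"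
    proof (intro equalityI subsetI)
      fix C assume C: "C \<in> rcosets H - {H}"
      then obtain x where x: "x \<in> carrier G" "C = H #> x" by (auto simp: RCOSETS_def)
      with C have "x \<notin> H" using coset_join2[OF _ is_subgroup, of x] by auto
      then have "inv x \<in> carrier G - H" using x by (metis Diff_iff inv_closed inv_inv m_inv_closed)
      then show "C \<in> (\<lambda>v. H #> inv v) ` (carrier G - H)"
        using x by (intro image_eqI[of _ _ "inv x"]) auto
    next
      fix C assume "C \<in> (\<lambda>v. H #> inv v) ` (carrier G - H)"
      then obtain v where v: "v \<in> carrier G" "v \<notin> H" "C = H #> inv v" by auto
      then have "C \<noteq> H"
        by (metis coset_join1 inv_closed inv_inv is_subgroup m_inv_closed subset)
      then show "C \<in> rcosets H - {H}" using v by (auto simp: RCOSETS_def)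
    qed
    have "H \<noteq> {}" "H \<subset> carrier G"
      using subgroup.one_closed[OF is_subgroup] proper subset by blast+
    moreover have "(\<forall>v\<in>H. neighbours (Cay G S) v \<inter> H = {}) \<longleftrightarrow> S \<inter> H = {}"
      using empty_iff \<open>H \<noteq> {}\<close> by blast
    moreover have "(\<forall>v\<in>carrier G - H. card (neighbours (Cay G S) v \<inter> H) = k) \<longleftrightarrow>
        (\<forall>C\<in>rcosets H - {H}. card (S \<inter> C) = k)"
      unfolding rcosets_eq using card_neighbours_Cay[OF _ S] by simp
    moreover have "pverts (Cay G S) = carrier G" by (simp add: Cay_def)
    ultimately show ?thesis unfolding zero_regular_set_in_def by simp
  qed
  then show ?thesis by (auto simp: zero_regular_set_of_def)
qed

text \<open>The criterion on the right does not mention \<open>k\<close>, so it serves as the common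
  middle term for any two odd values.\<close>

lemma (in normal) zero_regular_set_of_odd_iff:
  assumes fin: "finite (carrier G)" and proper: "H \<noteq> carrier G"
    and k: "odd k" "k \<le> card H"
  shows "zero_regular_set_of k G H \<longleftrightarrow>
    (\<forall>C\<in>rcosets H - {H}. set_inv C = C \<longrightarrow> (\<exists>x\<in>C. inv x = x))" (is "_ \<longleftrightarrow> ?R")
proof
  assume "zero_regular_set_of k G H"
  then obtain S where S: "connection_set G S" "\<And>C. C \<in> rcosets H - {H} \<Longrightarrow> card (S \<inter> C) = k"
    using zero_regular_set_of_iff[OF fin proper] by auto
  have sub: "S \<subseteq> carrier G" and inv_S: "set_inv S = S" using S by (auto simp: connection_set_def)
  show ?R
  proof (intro ballI impI)
    fix C assume C: "C \<in> rcosets H - {H}" "set_inv C = C"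
    have subC: "C \<subseteq> carrier G" using C rcosets_carrier[OF is_group] by auto
    have "\<exists>x\<in>S \<inter> C. inv x = x"
    proof (rule involution_fixed_point)
      show "finite (S \<inter> C)" using sub fin by (meson finite_subset finite_Int)
      show "odd (card (S \<inter> C))" using S(2) C k by auto
      show "inv x \<in> S \<inter> C" if "x \<in> S \<inter> C" for x
        using that in_set_inv_iff[OF sub, of x] in_set_inv_iff[OF subC, of x] inv_S C(2) sub by auto
      show "inv (inv x) = x" if "x \<in> S \<inter> C" for x
        using that sub by auto
    qed
    then show "\<exists>x\<in>C. inv x = x" by auto
  qed
next
  assume R: ?R
  have carr: "C \<subseteq> carrier G" if "C \<in> rcosets H" for C
    using that rcosets_carrier[OF is_group] by auto
  have inv_inv_coset: "set_inv (set_inv C) = C" if "C \<in> rcosets H" for C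
    using that carr set_inv_set_inv by auto
  have H_coset: "H \<in> rcosets H" using subgroup_in_rcosets[OF is_group] .
  have inv_H: "set_inv H = H" using rcos_inv[of \<one>] coset_mult_one[OF subset] by simp
  \<comment> \<open>First choose \<open>k\<close> elements in each coset separately. Only a
    self-inverse coset constrains the choice; agreement between distinct inverse cosets is arranged
    later by \<open>T\<close>.\<close>
  have "\<exists>A\<subseteq>C. card A = k \<and> (set_inv C = C \<longrightarrow> set_inv A = A)" if C: "C \<in> rcosets H - {H}" for C
  proof (cases "set_inv C = C")
    case True
    have subC: "C \<subseteq> carrier G" using C carr by auto
    obtain x where x: "x \<in> C" "inv x = x" using R C True by auto
    obtain n where n: "k = 2 * n + 1" using k(1) oddE by blast
    have "card C = card H" using C card_rcosets_equal[OF _ subset] by auto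
    moreover have "inv y \<in> C" if "y \<in> C" for y
      using that True in_set_inv_iff[OF subC, of y] subC by auto
    ultimately obtain A where A: "A \<subseteq> C" "card A = k" "\<forall>y\<in>A. inv y \<in> A"
      using involution_closed_subset_odd_card[of C "\<lambda>y. inv y" x n] x n k(2) subC fin
      by (force dest: finite_subset)
    have "set_inv A = A"
    proof -
      have "set_inv A \<subseteq> A" using A by (auto simp: SET_INV_def)
      moreover have "A \<subseteq> set_inv A" using A subC in_set_inv_iff[of A] by blast
      ultimately show ?thesis by blast
    qed
    then show ?thesis using A by auto
  next
    case False
    have "k \<le> card C" using C k card_rcosets_equal[OF _ subset] by auto
    then show ?thesis using False by (metis obtain_subset_with_card_n)
  qed
  then have "\<forall>C\<in>rcosets H - {H}. \<exists>A\<subseteq>C. card A = k \<and> (set_inv C = C \<longrightarrow> set_inv A = A)" by blast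
  then obtain A where A: "\<And>C. C \<in> rcosets H - {H} \<Longrightarrow>
      A C \<subseteq> C \<and> card (A C) = k \<and> (set_inv C = C \<longrightarrow> set_inv (A C) = A C)"
    by metis
  \<comment> \<open>\<open>r\<close> picks one coset from each pair \<open>{C, C\<inverse>}\<close>.\<close>
  define r where "r C = (SOME D. D \<in> {C, set_inv C})" for C
  have r: "r C = C \<or> r C = set_inv C" for C
    using someI[of "\<lambda>D. D \<in> {C, set_inv C}" C] by (auto simp: r_def)
  \<comment> \<open>The choice depends only on the unordered pair, which is the same set for a coset
    and its inverse.\<close>
  have r_inv: "r (set_inv C) = r C" if "C \<in> rcosets H" for C
    using inv_inv_coset[OF that] by (simp add: r_def insert_commute)
  \<comment> \<open>The chosen coset of a pair keeps its set \<open>A C\<close>; the other receives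
    the inverses of that set. A self-inverse coset always falls under the first case.\<close>
  define T where "T C = (if r C = C then A C else set_inv (A (r C)))" for C
  have inv_coset: "set_inv C \<in> rcosets H - {H}" if "C \<in> rcosets H - {H}" for C
    using that set_inv_rcosets inv_inv_coset inv_H by (metis Diff_iff singletonD singletonI)
  have A_carr: "A C \<subseteq> carrier G" if "C \<in> rcosets H - {H}" for C
    using A[OF that] carr that by blast
  have T: "T C \<subseteq> C" "card (T C) = k" "set_inv (T C) = T (set_inv C)"
    if C: "C \<in> rcosets H - {H}" for C
  proof -
    note C' = inv_coset[OF C]
    have CC: "set_inv (set_inv C) = C" and rr: "r (set_inv C) = r C"
      using C inv_inv_coset r_inv by auto
    have "T C \<subseteq> C \<and> card (T C) = k \<and> set_inv (T C) = T (set_inv C)"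
    proof (cases "set_inv C = C")
      case True
      then have "T C = A C" using r[of C] by (auto simp: T_def)
      then show ?thesis using A[OF C] True by simp
    next
      case ne: False
      show ?thesis
      proof (cases "r C = C")
        case True
        then have "T C = A C" "T (set_inv C) = set_inv (A C)" using ne rr by (simp_all add: T_def)
        then show ?thesis using A[OF C] by simp
      next
        case False
        then have "r C = set_inv C" using r[of C] by blast
        then have T_eq: "T C = set_inv (A (set_inv C))" "T (set_inv C) = A (set_inv C)"
          using ne rr by (simp_all add: T_def)
        have "T C \<subseteq> set_inv (set_inv C)"
          using A[OF C'] unfolding T_eq by (auto simp: SET_INV_def)
        then have "T C \<subseteq> C" unfolding CC .
        moreover have "card (T C) = k"
          using A[OF C'] card_set_inv[OF A_carr[OF C']] unfolding T_eq by simp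
        moreover have "set_inv (T C) = T (set_inv C)"
          using set_inv_set_inv[OF A_carr[OF C']] unfolding T_eq .
        ultimately show ?thesis by blast
      qed
    qed
    then show "T C \<subseteq> C" "card (T C) = k" "set_inv (T C) = T (set_inv C)" by blast+
  qed
  define S where "S = (\<Union>C\<in>rcosets H - {H}. T C)"
  have S_carr: "S \<subseteq> carrier G" using T(1) carr unfolding S_def by blast
  \<comment> \<open>Distinct cosets are disjoint, so only the piece \<open>T C\<close> of the union
    can meet \<open>C\<close>.\<close>
  have S_Int: "S \<inter> C = (if C = H then {} else T C)" if "C \<in> rcosets H" for C
  proof -
    have "D \<inter> C = {}" if "D \<in> rcosets H" "D \<noteq> C" for D
      using that \<open>C \<in> rcosets H\<close> rcos_disjoint[OF is_subgroup] by (auto simp: pairwise_def disjnt_def)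
    then show ?thesis using T(1) that unfolding S_def by (auto; blast)
  qed
  have "set_inv S = S"
  proof -
    have "set_inv S \<subseteq> S"
    proof
      fix x assume "x \<in> set_inv S"
      then obtain C where "C \<in> rcosets H - {H}" "x \<in> set_inv (T C)"
        by (auto simp: S_def SET_INV_def)
      then show "x \<in> S" using T(3) inv_coset unfolding S_def by blast
    qed
    \<comment> \<open>Inverting the inclusion just proved yields the reverse one, since inverting
      twice gives back \<open>S\<close>.\<close>
    moreover from this have "set_inv (set_inv S) \<subseteq> set_inv S" by (auto simp: SET_INV_def)
    ultimately show ?thesis using set_inv_set_inv[OF S_carr] by auto
  qed
  moreover have "S \<inter> H = {}" using S_Int[OF H_coset] by simp
  ultimately have "connection_set G S" using S_carr subgroup.one_closed[OF is_subgroup]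
    by (auto simp: connection_set_def)
  moreover have "\<forall>C\<in>rcosets H - {H}. card (S \<inter> C) = k" using S_Int T(2) by auto
  ultimately show "zero_regular_set_of k G H"
    using \<open>S \<inter> H = {}\<close> zero_regular_set_of_iff[OF fin proper] by auto
qed

theorem corollary4p5:
  fixes G :: "('a, 'b) monoid_scheme" and H :: "'a set"
  assumes "group G"
    and "finite (carrier G)"
    and "H \<lhd> G"
    and "H \<noteq> {\<one>\<^bsub>G\<^esub>}"
    and "H \<noteq> carrier G"
  shows "(\<forall>k l. odd k \<longrightarrow> k \<in> {1..card H} \<longrightarrow> odd l \<longrightarrow> l \<in> {1..card H} \<longrightarrow>
            (zero_regular_set_of k G H \<longleftrightarrow> zero_regular_set_of l G H)) \<and>
         (\<forall>k. odd k \<longrightarrow> k \<in> {1..card H} \<longrightarrow>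
            (zero_regular_set_of 1 G H \<longleftrightarrow> zero_regular_set_of k G H))"
proof -
  interpret normal H G by fact
  have "zero_regular_set_of k G H \<longleftrightarrow> zero_regular_set_of l G H"
    if "odd k" "k \<in> {1..card H}" "odd l" "l \<in> {1..card H}" for k l
    using that zero_regular_set_of_odd_iff[OF assms(2,5)] by auto
  \<comment> \<open>The second claim is the case of the pair 1, k; the range of \<open>k\<close>
    forces 1 \<le> card H.\<close>
  moreover have "1 \<in> {1..card H}" if "k \<in> {1..card H}" for k
    using that by auto
  ultimately show ?thesis by (metis odd_one)
qed

end
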